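(* Fix $\kappa>0$. For each dimension $d>2$ let $p=p^{(d)}$ be the density of a Gaussian distribution $\mathcal{N}(0,I+S)$ on $\mathbb{R}^d$, where the symmetric matrix $S\in\mathbb{R}^{d\times d}$ satisfies $|S_{ij}|\le d^{-(2+\kappa)}$ for all $1\le i,j\le d$, and let $q=q^{(d)}$ be a probability density on $\mathbb{R}^d$ such that $\|p-q\|_1=\Theta(1)$ as $d\to\infty$. Let $\mathcal{F}$ be the set of all Householder flows on $\mathbb{R}^d$. Then there exists $\epsilon=\epsilon(d)=\Theta(1)$ such that, as $d\to\infty$, \[T_{\epsilon}(p,q,\mathcal{F})=\Omega\left(d^{\kappa}\right).\]
   Context: A Householder flow on $\mathbb{R}^d$ is a map $f(z)=z-2vv^{\top}z$ with $v\in\mathbb{R}^d$ a unit vector. If $z$ has density $q$, $f\#q$ denotes the density of $f(z)$. For a set $\mathcal F$ of invertible maps and $\epsilon>0$, \[T_\epsilon(p,q,\mathcal F)=\inf\{n:\exists f_1,\dots,f_n\in\mathcal F\text{ with }\|(f_1\circ\cdots\circ f_n)\#q-p\|_1\le\epsilon\}\] (with $\inf\emptyset=\infty$), where $\|\cdot\|_1$ is the $L^1(\mathbb{R}^d)$ norm. *)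

theory Defs
  imports
    "HOL-Analysis.Analysis"
    "HOL-Library.Landau_Symbols"
    "Jordan_Normal_Form.Determinant"
    "Jordan_Normal_Form.Gauss_Jordan_Elimination"
begin

text \<open>Since the dimension \<open>d\<close> tends to infinity inside the statement, \<open>\<real>\<^sup>d\<close> is the space of
  extensional functions on \<open>{..<d}\<close>, carrying the product Lebesgue measure.\<close>

definition lborel_Rn :: "nat \<Rightarrow> (nat \<Rightarrow> real) measure" where
  "lborel_Rn d = (\<Pi>\<^sub>M i\<in>{..<d}. lborel)"

definition L1_norm :: "nat \<Rightarrow> ((nat \<Rightarrow> real) \<Rightarrow> real) \<Rightarrow> real" where
  "L1_norm d g = (\<integral>x. \<bar>g x\<bar> \<partial>lborel_Rn d)"

definition prob_density :: "nat \<Rightarrow> ((nat \<Rightarrow> real) \<Rightarrow> real) \<Rightarrow> bool" where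
  "prob_density d q \<longleftrightarrow>
     q \<in> borel_measurable (lborel_Rn d) \<and>
     (AE x in lborel_Rn d. 0 \<le> q x) \<and>
     (\<integral>\<^sup>+x. ennreal (q x) \<partial>lborel_Rn d) = 1"

text \<open>The density of the centred Gaussian with (positive definite) covariance matrix \<open>\<Sigma>\<close>.\<close>

definition gaussian_density :: "nat \<Rightarrow> real mat \<Rightarrow> (nat \<Rightarrow> real) \<Rightarrow> real" where
  "gaussian_density d \<Sigma> x =
     exp (- (scalar_prod (Matrix.vec d x) (the (mat_inverse \<Sigma>) *\<^sub>v Matrix.vec d x)) / 2)
       / sqrt ((2 * pi) ^ d * Determinant.det \<Sigma>)"

text \<open>\<open>f#q\<close>: the Lebesgue density of the law of \<open>f z\<close> when \<open>z\<close> has density \<open>q\<close>.  Like any density it is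
  determined only up to null sets.\<close>

definition push_density ::
  "nat \<Rightarrow> ((nat \<Rightarrow> real) \<Rightarrow> (nat \<Rightarrow> real)) \<Rightarrow> ((nat \<Rightarrow> real) \<Rightarrow> real) \<Rightarrow> (nat \<Rightarrow> real) \<Rightarrow> real" where
  "push_density d f q x =
     enn2real (RN_deriv (lborel_Rn d)
       (distr (density (lborel_Rn d) (\<lambda>z. ennreal (q z))) (lborel_Rn d) f) x)"

definition householder :: "nat \<Rightarrow> (nat \<Rightarrow> real) \<Rightarrow> (nat \<Rightarrow> real) \<Rightarrow> (nat \<Rightarrow> real)" where
  "householder d v z = (\<lambda>i\<in>{..<d}. z i - 2 * v i * (\<Sum>j<d. v j * z j))"

definition householder_flows :: "nat \<Rightarrow> ((nat \<Rightarrow> real) \<Rightarrow> (nat \<Rightarrow> real)) set" where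
  "householder_flows d = {householder d v | v. (\<Sum>i<d. (v i)\<^sup>2) = 1}"

text \<open>The list \<open>fs\<close> is \<open>[f\<^sub>1, \<dots>, f\<^sub>n]\<close>; the value \<open>n = 0\<close> (empty composition) is allowed, and the
  infimum of the empty set in \<^typ>\<open>enat\<close> is \<open>\<infinity>\<close>.\<close>

definition T_flows ::
  "nat \<Rightarrow> real \<Rightarrow> ((nat \<Rightarrow> real) \<Rightarrow> real) \<Rightarrow> ((nat \<Rightarrow> real) \<Rightarrow> real)
    \<Rightarrow> ((nat \<Rightarrow> real) \<Rightarrow> (nat \<Rightarrow> real)) set \<Rightarrow> enat" where
  "T_flows d \<epsilon> p q F =
     Inf {enat (length fs) | fs. set fs \<subseteq> F \<and>
            L1_norm d (\<lambda>x. push_density d (foldr (\<circ>) fs id) q x - p x) \<le> \<epsilon>}"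

text \<open>\<open>\<Omega>\<close> for sequences that may take the value \<open>\<infinity>\<close>.\<close>

definition enat_bigomega :: "(nat \<Rightarrow> enat) \<Rightarrow> (nat \<Rightarrow> real) \<Rightarrow> bool" where
  "enat_bigomega t g \<longleftrightarrow>
     (\<exists>c>0. eventually (\<lambda>d. ereal (c * \<bar>g d\<bar>) \<le> ereal_of_enat (t d)) at_top)"

end

theory Submission
  imports Defs "HOL-Probability.Distributions"
begin

text \<open>Compositions of Householder flows are orthogonal, so they preserve Lebesgue measure and the
  standard Gaussian density \<open>\<phi>\<close>.  Hence \<open>\<parallel>f#q - \<phi>\<parallel> = \<parallel>q - \<phi>\<parallel>\<close> and \<open>\<parallel>f#q - p\<parallel> \<ge> \<parallel>q - p\<parallel> - 2 \<parallel>p - \<phi>\<parallel>\<close> for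
  any number of flows.  The entries of \<open>S\<close> are so small that \<open>\<parallel>p - \<phi>\<parallel> \<longlonglongrightarrow> 0\<close>.  If \<open>\<parallel>p - q\<parallel> \<ge> c\<close> for
  large \<open>d\<close>, the constant \<open>\<epsilon> = c / 2\<close> is therefore never reached and \<open>T\<^sub>\<epsilon>\<close> is eventually infinite.\<close>

section \<open>Perturbations of the identity matrix\<close>

text \<open>Expanding the product of row sums gives one nonnegative term for every map of
  \<open>{0..<d}\<close> into itself; the permutations select only some of these terms.\<close>

lemma sum_permutations_le_prod_row_sums:
  fixes e :: "nat \<Rightarrow> nat \<Rightarrow> real"
  assumes "\<And>i j. 0 \<le> e i j"
  shows "(\<Sum>p | p permutes {0..<d}. \<Prod>i=0..<d. e i (p i)) \<le> (\<Prod>i=0..<d. \<Sum>j=0..<d. e i j)"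
proof -
  \<comment> \<open>A permutation is the identity outside \<open>{0..<d}\<close>, while members of
    \<open>Pi\<^sub>E\<close> are \<open>undefined\<close> there. Restriction translates between the
    two and loses nothing.\<close>
  let ?P = "{p. p permutes {0..<d}}" and ?r = "\<lambda>p. restrict p {0..<d}"
  have inj: "inj_on ?r ?P"
  proof (rule inj_onI)
    fix p p' assume p: "p \<in> ?P" "p' \<in> ?P" and eq: "?r p = ?r p'"
    show "p = p'"
    proof
      fix i show "p i = p' i"
        using p fun_cong[OF eq, of i] by (cases "i \<in> {0..<d}") (auto simp: permutes_def)
    qed
  qed
  have "(\<Sum>p\<in>?P. \<Prod>i=0..<d. e i (p i)) = (\<Sum>g\<in>?r ` ?P. \<Prod>i=0..<d. e i (g i))"
    by (subst sum.reindex[OF inj]) (auto intro!: sum.cong prod.cong)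
  also have "\<dots> \<le> (\<Sum>g\<in>Pi\<^sub>E {0..<d} (\<lambda>_. {0..<d}). \<Prod>i=0..<d. e i (g i))"
    using assms
    by (intro sum_mono2 prod_nonneg finite_PiE)
       (auto dest: permutes_in_image simp: PiE_iff permutes_def)
  also have "\<dots> = (\<Prod>i=0..<d. \<Sum>j=0..<d. e i j)"
    by (rule prod_sum_PiE[symmetric]) auto
  finally show ?thesis .
qed

text \<open>Leibniz formula: only the identity permutation yields a term near 1, and every other
  term is bounded by its absolute value. The entrywise majorants sum to at most a product of row
  sums, each at most \<open>1 + d * s\<close>, so the error is small as soon as
  \<open>d^2 * s\<close> is.\<close>

lemma det_one_plus_bound:
  fixes S :: "real mat"
  assumes S: "S \<in> carrier_mat d d"
    and s: "\<And>i j. i < d \<Longrightarrow> j < d \<Longrightarrow> \<bar>S $$ (i, j)\<bar> \<le> s"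
  shows "\<bar>Determinant.det (1\<^sub>m d + S) - 1\<bar> \<le> (1 + real d * s) ^ d - 1"
proof -
  let ?P = "{p. p permutes {0..<d}}"
  define f where "f p = signof p * (\<Prod>i=0..<d. (1\<^sub>m d + S) $$ (i, p i))" for p
  \<comment> \<open>An entrywise majorant of \<open>1 + S\<close> that keeps the diagonal 1 apart
    from \<open>S\<close>, so that subtracting 1 from \<open>F id\<close> leaves only perturbation
    terms.\<close>
  define e where "e i j = (if i = j then 1 else 0) + \<bar>S $$ (i, j)\<bar>" for i j
  define F where "F p = (\<Prod>i=0..<d. e i (p i))" for p
  have fin: "finite ?P" and id: "id \<in> ?P" by (auto simp: finite_permutations permutes_id)
  have det: "Determinant.det (1\<^sub>m d + S) = (\<Sum>p\<in>?P. f p)"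
    using S unfolding f_def by (subst det_def'[of _ d]) auto
  have le: "\<bar>f p\<bar> \<le> F p" if "p \<in> ?P" for p
  proof -
    have "\<bar>f p\<bar> = (\<Prod>i=0..<d. \<bar>(1\<^sub>m d + S) $$ (i, p i)\<bar>)"
      by (simp add: f_def abs_mult sign_def abs_prod)
    also have "\<dots> \<le> F p"
      unfolding F_def
    proof (intro prod_mono conjI)
      fix i assume i: "i \<in> {0..<d}"
      then have "p i < d" using that permutes_in_image[of p "{0..<d}" i] by auto
      then show "\<bar>(1\<^sub>m d + S) $$ (i, p i)\<bar> \<le> e i (p i)" using i S by (auto simp: e_def)
    qed auto
    finally show ?thesis .
  qed
  \<comment> \<open>The identity term needs a finer estimate than its absolute value, since its
    leading 1 must cancel: |prod (1 + x_i) - 1| \<le> prod (1 + |x_i|) - 1.\<close>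
  have le_id: "\<bar>f id - 1\<bar> \<le> F id - 1"
  proof -
    have "f id = (\<Prod>i=0..<d. 1 + S $$ (i, i))"
      using S by (auto simp: f_def sign_def intro!: prod.cong)
    moreover have "F id = (\<Prod>i=0..<d. 1 + \<bar>S $$ (i, i)\<bar>)"
      by (auto simp: F_def e_def)
    ultimately show ?thesis
      using norm_prod_minus1_le_prod_minus1[of "\<lambda>i. S $$ (i, i)" "{0..<d}"] by simp
  qed
  have "\<bar>Determinant.det (1\<^sub>m d + S) - 1\<bar> = \<bar>(f id - 1) + (\<Sum>p\<in>?P - {id}. f p)\<bar>"
    unfolding det by (subst sum.remove[OF fin id]) simp
  also have "\<dots> \<le> \<bar>f id - 1\<bar> + (\<Sum>p\<in>?P - {id}. \<bar>f p\<bar>)"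
    using sum_abs[of f "?P - {id}"] by linarith
  also have "\<dots> \<le> (F id - 1) + (\<Sum>p\<in>?P - {id}. F p)"
    by (intro add_mono sum_mono le le_id) auto
  also have "\<dots> = (\<Sum>p\<in>?P. F p) - 1"
    using sum.remove[OF fin id, of F] by simp
  also have "(\<Sum>p\<in>?P. F p) \<le> (\<Prod>i=0..<d. \<Sum>j=0..<d. e i j)"
    unfolding F_def by (rule sum_permutations_le_prod_row_sums) (auto simp: e_def)
  also have "\<dots> \<le> (\<Prod>i=0..<d. 1 + real d * s)"
  proof (intro prod_mono conjI sum_nonneg)
    fix i assume i: "i \<in> {0..<d}"
    have "(\<Sum>j=0..<d. e i j) = 1 + (\<Sum>j=0..<d. \<bar>S $$ (i, j)\<bar>)"
      using i by (simp add: e_def sum.distrib)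
    also have "(\<Sum>j=0..<d. \<bar>S $$ (i, j)\<bar>) \<le> (\<Sum>j=0..<d. s)"
      using i s by (intro sum_mono) auto
    finally show "(\<Sum>j=0..<d. e i j) \<le> 1 + real d * s" by simp
  qed (auto simp: e_def)
  finally show ?thesis by simp
qed

section \<open>The inverse of a perturbed identity matrix as a quadratic form\<close>

lemma the_mat_inverse:
  fixes A :: "'a :: field mat"
  assumes A: "A \<in> carrier_mat d d" and det: "Determinant.det A \<noteq> 0"
  shows "A * the (mat_inverse A) = 1\<^sub>m d" "the (mat_inverse A) \<in> carrier_mat d d"
proof -
  obtain B where "mat_inverse A = Some B"
    \<comment> \<open>\<open>mat_inverse\<close> yields \<open>None\<close> only for matrices that
      are not units, which a nonzero determinant excludes.\<close>
    using mat_inverse(1)[OF A, where b = "()"] det_non_zero_imp_unit[OF A det, where b = "()"]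
    by (cases "mat_inverse A") auto
  then show "A * the (mat_inverse A) = 1\<^sub>m d" "the (mat_inverse A) \<in> carrier_mat d d"
    using mat_inverse(2)[OF A] by auto
qed

text \<open>Apply |x_i y_j| \<le> (x_i^2 + y_j^2) / 2 to each term; every square then occurs
  \<open>d\<close> times in the double sum, hence the factor \<open>d * s\<close>.\<close>

lemma bilinear_small_entries:
  fixes a :: "nat \<Rightarrow> nat \<Rightarrow> real"
  assumes s: "\<And>i j. i < d \<Longrightarrow> j < d \<Longrightarrow> \<bar>a i j\<bar> \<le> s"
  shows "\<bar>\<Sum>i<d. x i * (\<Sum>j<d. a i j * y j)\<bar> \<le> real d * s * ((\<Sum>i<d. (x i)\<^sup>2) + (\<Sum>i<d. (y i)\<^sup>2)) / 2"
proof -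
  have "\<bar>\<Sum>i<d. x i * (\<Sum>j<d. a i j * y j)\<bar> = \<bar>\<Sum>i<d. \<Sum>j<d. x i * (a i j * y j)\<bar>"
    by (simp add: sum_distrib_left)
  also have "\<dots> \<le> (\<Sum>i<d. \<Sum>j<d. \<bar>x i * (a i j * y j)\<bar>)"
    by (rule order_trans[OF sum_abs]) (intro sum_mono sum_abs)
  also have "\<dots> \<le> (\<Sum>i<d. \<Sum>j<d. s * (((x i)\<^sup>2 + (y j)\<^sup>2) / 2))"
  proof (intro sum_mono)
    fix i j assume ij: "i \<in> {..<d}" "j \<in> {..<d}"
    have "\<bar>x i * (a i j * y j)\<bar> = \<bar>a i j\<bar> * (\<bar>x i\<bar> * \<bar>y j\<bar>)" by (simp add: abs_mult)
    also have "\<dots> \<le> s * (((x i)\<^sup>2 + (y j)\<^sup>2) / 2)"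
    proof (rule mult_mono)
      show "\<bar>x i\<bar> * \<bar>y j\<bar> \<le> ((x i)\<^sup>2 + (y j)\<^sup>2) / 2"
      using sum_squares_bound[of "\<bar>x i\<bar>" "\<bar>y j\<bar>"] by simp
      show "\<bar>a i j\<bar> \<le> s" "0 \<le> s" using s[of i j] ij by auto
    qed simp
    finally show "\<bar>x i * (a i j * y j)\<bar> \<le> s * (((x i)\<^sup>2 + (y j)\<^sup>2) / 2)" .
  qed
  also have "\<dots> = real d * s * ((\<Sum>i<d. (x i)\<^sup>2) + (\<Sum>i<d. (y i)\<^sup>2)) / 2"
  proof -
    have "(\<Sum>i<d. \<Sum>j<d. s * (((x i)\<^sup>2 + (y j)\<^sup>2) / 2)) = s / 2 * (\<Sum>i<d. \<Sum>j<d. (x i)\<^sup>2 + (y j)\<^sup>2)"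
      by (simp add: sum_distrib_left)
    also have "(\<Sum>i<d. \<Sum>j<d. (x i)\<^sup>2 + (y j)\<^sup>2) = real d * (\<Sum>i<d. (x i)\<^sup>2) + real d * (\<Sum>i<d. (y i)\<^sup>2)"
      by (simp add: sum.distrib sum_distrib_left)
    finally show ?thesis by (simp add: distrib_left mult.commute mult.left_commute)
  qed
  finally show ?thesis .
qed

definition sq_norm :: "nat \<Rightarrow> (nat \<Rightarrow> real) \<Rightarrow> real" where
  "sq_norm d x = (\<Sum>i<d. (x i)\<^sup>2)"

text \<open>The inverse is never expanded. With y the image of x under the inverse, x = y + S y, so
  |x|^2 and x . y differ by x . S y. This is small relative to |x|^2 + |y|^2, and |y| is controlled
  by |x|.\<close>

lemma inverse_quadratic_form_bound:
  fixes S :: "real mat"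
  assumes S: "S \<in> carrier_mat d d"
    and s: "\<And>i j. i < d \<Longrightarrow> j < d \<Longrightarrow> \<bar>S $$ (i, j)\<bar> \<le> s"
    and ds: "0 \<le> s" "real d * s \<le> 1 / 4"
    and det: "Determinant.det (1\<^sub>m d + S) \<noteq> 0"
  shows "\<bar>scalar_prod (Matrix.vec d x) (the (mat_inverse (1\<^sub>m d + S)) *\<^sub>v Matrix.vec d x) - sq_norm d x\<bar>
           \<le> 2 * (real d * s) * sq_norm d x"
proof -
  let ?\<Sigma> = "1\<^sub>m d + S"
  have \<Sigma>: "?\<Sigma> \<in> carrier_mat d d" using S by simp
  define B where "B = the (mat_inverse ?\<Sigma>)"
  have inv: "?\<Sigma> * B = 1\<^sub>m d" and B: "B \<in> carrier_mat d d"
    using the_mat_inverse[OF \<Sigma> det] by (simp_all add: B_def)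
  define w where "w = B *\<^sub>v Matrix.vec d x"
  define y where "y i = vec_index w i" for i :: nat
  define b where "b u z = (\<Sum>i<d. u i * (\<Sum>j<d. S $$ (i, j) * z j))" for u z :: "nat \<Rightarrow> real"
  let ?\<eta> = "real d * s" and ?X = "sq_norm d x" and ?Y = "sq_norm d y"
  have w: "w \<in> carrier_vec d" using B by (simp add: w_def)
  have dot: "scalar_prod (Matrix.vec d x) w = (\<Sum>i<d. x i * y i)"
    using w by (simp add: scalar_prod_def y_def atLeast0LessThan)
  have "?\<Sigma> *\<^sub>v w = Matrix.vec d x"
    unfolding w_def using B \<Sigma> by (subst assoc_mult_mat_vec[symmetric, of _ d d]) (auto simp: inv)
  then have \<Sigma>w: "x i = vec_index (?\<Sigma> *\<^sub>v w) i" if "i < d" for i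
    using that by simp
  have xy: "x i = y i + (\<Sum>j<d. S $$ (i, j) * y j)" if i: "i < d" for i
  proof -
    have "vec_index (?\<Sigma> *\<^sub>v w) i = (\<Sum>j<d. ?\<Sigma> $$ (i, j) * y j)"
      using i w S by (simp add: scalar_prod_def y_def atLeast0LessThan eq_commute[of i])
    also have "\<dots> = (\<Sum>j<d. (if i = j then y j else 0) + S $$ (i, j) * y j)"
      using i S by (intro sum.cong) (auto simp: distrib_right)
    also have "\<dots> = y i + (\<Sum>j<d. S $$ (i, j) * y j)"
      using i by (simp add: sum.distrib)
    finally show ?thesis using \<Sigma>w[OF i] by simp
  qed
  have b: "\<bar>b u z\<bar> \<le> ?\<eta> * (sq_norm d u + sq_norm d z) / 2" for u z
    unfolding b_def sq_norm_def by (rule bilinear_small_entries) (rule s)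
  \<comment> \<open>Pairing x = y + S y with y will bound |y|; pairing it with x, next, isolates the
    error \<open>b x y\<close>.\<close>
  have e1: "(\<Sum>i<d. x i * y i) = ?Y + b y y"
    unfolding b_def sq_norm_def sum.distrib[symmetric]
    by (intro sum.cong) (auto simp: xy algebra_simps power2_eq_square)
  have e2: "?X = (\<Sum>i<d. x i * y i) + b x y"
  proof -
    have "?X = (\<Sum>i<d. x i * (y i + (\<Sum>j<d. S $$ (i, j) * y j)))"
      unfolding sq_norm_def by (intro sum.cong) (auto simp: xy[symmetric] power2_eq_square)
    then show ?thesis by (simp add: b_def algebra_simps sum.distrib)
  qed
  have X0: "0 \<le> ?X" and Y0: "0 \<le> ?Y" by (auto simp: sq_norm_def sum_nonneg)
  have "(\<Sum>i<d. x i * y i) \<le> (?X + ?Y) / 2"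
    unfolding sq_norm_def sum.distrib[symmetric] sum_divide_distrib
    using sum_squares_bound[of "x i" "y i" for i] by (intro sum_mono) (simp add: field_simps)
  moreover have "- b y y \<le> ?Y / 4"
  proof -
    have "- b y y \<le> ?\<eta> * ?Y" using b[of y y] by (simp add: abs_le_iff)
    also have "\<dots> \<le> 1 / 4 * ?Y" using ds Y0 by (intro mult_right_mono)
    finally show ?thesis by simp
  qed
  \<comment> \<open>Combining the three facts gives Y \<le> X/2 + Y/2 + Y/4, and the quarter of Y
    left over is why \<open>d * s \<le> 1 / 4\<close> is assumed.\<close>
  moreover have "Y \<le> 2 * X" if "P \<le> (X + Y) / 2" "- B \<le> Y / 4" "P = Y + B" for P B X Y :: real
    using that by (simp add: field_simps)
  ultimately have "?Y \<le> 2 * ?X" using e1 by blast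
  \<comment> \<open>Here X + Y \<le> 3 X, rounded up to 4 X to give the constant 2.\<close>
  then have "?\<eta> * (?X + ?Y) / 2 \<le> ?\<eta> * (4 * ?X) / 2"
    using ds X0 by (intro divide_right_mono mult_left_mono) auto
  from order_trans[OF b[of x y] this] have "\<bar>b x y\<bar> \<le> 2 * ?\<eta> * ?X"
    by (simp add: mult_ac)
  then show ?thesis unfolding B_def[symmetric] w_def[symmetric] dot using e2 by linarith
qed

section \<open>Householder flows preserve volume\<close>

interpretation lborel_prod: product_sigma_finite "\<lambda>_ :: nat. lborel :: real measure"
  by standard

lemma space_lborel_Rn: "space (lborel_Rn d) = Pi\<^sub>E {..<d} (\<lambda>_. UNIV)"
  by (simp add: lborel_Rn_def space_PiM)

lemma measurable_coordinate [measurable]: "i < d \<Longrightarrow> (\<lambda>x. x i) \<in> borel_measurable (lborel_Rn d)"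
  unfolding lborel_Rn_def by measurable

lemma sigma_finite_lborel_Rn: "sigma_finite_measure (lborel_Rn d)"
  unfolding lborel_Rn_def by (rule lborel_prod.sigma_finite) simp

text \<open>The change-of-variables formula for a map of constant absolute Jacobian
  \<open>c\<close>. Stated for nonnegative integrals, it composes directly and can be checked with
  Fubini.\<close>

definition scales_volume :: "nat \<Rightarrow> ((nat \<Rightarrow> real) \<Rightarrow> (nat \<Rightarrow> real)) \<Rightarrow> real \<Rightarrow> bool" where
  "scales_volume d f c \<longleftrightarrow> f \<in> lborel_Rn d \<rightarrow>\<^sub>M lborel_Rn d \<and>
     (\<forall>F\<in>borel_measurable (lborel_Rn d).
        ennreal c * (\<integral>\<^sup>+x. F (f x) \<partial>lborel_Rn d) = (\<integral>\<^sup>+x. F x \<partial>lborel_Rn d))"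

lemma scales_volume_comp:
  assumes f: "scales_volume d f a" and g: "scales_volume d g b" and "0 \<le> a" "0 \<le> b"
  shows "scales_volume d (f \<circ> g) (a * b)"
  unfolding scales_volume_def
proof safe
  have [measurable]: "f \<in> lborel_Rn d \<rightarrow>\<^sub>M lborel_Rn d" "g \<in> lborel_Rn d \<rightarrow>\<^sub>M lborel_Rn d"
    using f g by (auto simp: scales_volume_def)
  then show "f \<circ> g \<in> lborel_Rn d \<rightarrow>\<^sub>M lborel_Rn d" by measurable
  fix F :: "(nat \<Rightarrow> real) \<Rightarrow> ennreal" assume F[measurable]: "F \<in> borel_measurable (lborel_Rn d)"
  have "(\<lambda>x. F (f x)) \<in> borel_measurable (lborel_Rn d)" by measurable
  then have "ennreal b * (\<integral>\<^sup>+x. F (f (g x)) \<partial>lborel_Rn d) = (\<integral>\<^sup>+x. F (f x) \<partial>lborel_Rn d)"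
    using g by (auto simp: scales_volume_def)
  moreover have "ennreal a * (\<integral>\<^sup>+x. F (f x) \<partial>lborel_Rn d) = (\<integral>\<^sup>+x. F x \<partial>lborel_Rn d)"
    using f F by (auto simp: scales_volume_def)
  ultimately show "ennreal (a * b) * (\<integral>\<^sup>+x. F ((f \<circ> g) x) \<partial>lborel_Rn d) = (\<integral>\<^sup>+x. F x \<partial>lborel_Rn d)"
    using assms(3,4) by (simp add: ennreal_mult mult.assoc)
qed

lemma scales_volume_cong:
  assumes "\<And>x. x \<in> space (lborel_Rn d) \<Longrightarrow> f x = g x"
  shows "scales_volume d f c \<longleftrightarrow> scales_volume d g c"
  unfolding scales_volume_def using assms
  by (intro conj_cong measurable_cong ball_cong refl arg_cong2[where f = "(=)"] arg_cong2[where f = "(*)"] nn_integral_cong)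
     auto

lemma scales_volume_one_imp_distr:
  assumes "scales_volume d f 1"
  shows "distr (lborel_Rn d) (lborel_Rn d) f = lborel_Rn d"
proof (rule measure_eqI)
  have f[measurable]: "f \<in> lborel_Rn d \<rightarrow>\<^sub>M lborel_Rn d" using assms by (simp add: scales_volume_def)
  fix A assume "A \<in> sets (distr (lborel_Rn d) (lborel_Rn d) f)"
  then have A[measurable]: "A \<in> sets (lborel_Rn d)" by simp
  have "emeasure (distr (lborel_Rn d) (lborel_Rn d) f) A = (\<integral>\<^sup>+x. indicator A x \<partial>distr (lborel_Rn d) (lborel_Rn d) f)"
    by simp
  also have "\<dots> = (\<integral>\<^sup>+x. indicator A (f x) \<partial>lborel_Rn d)"
    by (rule nn_integral_distr) auto
  also have "\<dots> = (\<integral>\<^sup>+x. indicator A x \<partial>lborel_Rn d)"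
    using assms unfolding scales_volume_def by (auto dest!: bspec[of _ _ "indicator A"])
  finally show "emeasure (distr (lborel_Rn d) (lborel_Rn d) f) A = emeasure (lborel_Rn d) A" by simp
qed simp

text \<open>Integrate over coordinate \<open>k\<close> first. By \<open>ck\<close> the offset
  \<open>c x\<close> is constant along that coordinate, so with the others frozen the map is affine
  on the line with slope \<open>a\<close>.\<close>

lemma scales_volume_update:
  assumes k: "k < d" and a: "a \<noteq> 0"
    and c[measurable]: "c \<in> borel_measurable (lborel_Rn d)"
    and ck: "\<And>x t. c (x(k := t)) = c x"
  shows "scales_volume d (\<lambda>x. x(k := a * x k + c x)) \<bar>a\<bar>"
  unfolding scales_volume_def
proof safe
  let ?J = "{..<d} - {k}"
  have ins: "{..<d} = insert k ?J" using k by auto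
  have "(\<lambda>x. x(k := a * x k + c x)) \<in> lborel_Rn d \<rightarrow>\<^sub>M Pi\<^sub>M {..<d} (\<lambda>_. lborel)"
  proof (rule measurable_fun_upd)
    show "{..<d} = {..<d} \<union> {k}" using k by auto
    show "(\<lambda>x. x) \<in> lborel_Rn d \<rightarrow>\<^sub>M Pi\<^sub>M {..<d} (\<lambda>_. lborel)" by (simp add: lborel_Rn_def)
    show "(\<lambda>x. a * x k + c x) \<in> lborel_Rn d \<rightarrow>\<^sub>M lborel" using k by measurable
  qed
  then show m[measurable]: "(\<lambda>x. x(k := a * x k + c x)) \<in> lborel_Rn d \<rightarrow>\<^sub>M lborel_Rn d"
    by (simp add: lborel_Rn_def)
  fix F :: "(nat \<Rightarrow> real) \<Rightarrow> ennreal" assume F[measurable]: "F \<in> borel_measurable (lborel_Rn d)"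
  have Fubini: "(\<integral>\<^sup>+x. G x \<partial>lborel_Rn d) =
      (\<integral>\<^sup>+x. (\<integral>\<^sup>+t. G (x(k := t)) \<partial>lborel) \<partial>Pi\<^sub>M ?J (\<lambda>_. lborel))"
    if "G \<in> borel_measurable (lborel_Rn d)" for G :: "(nat \<Rightarrow> real) \<Rightarrow> ennreal"
    using that unfolding lborel_Rn_def
    by (subst (asm) ins, subst ins, subst lborel_prod.product_nn_integral_insert) auto
  have upd: "(\<lambda>t. G (x(k := t))) \<in> borel_measurable lborel"
    if "G \<in> borel_measurable (lborel_Rn d)" "x \<in> space (Pi\<^sub>M ?J (\<lambda>_. lborel))"
    for G :: "(nat \<Rightarrow> real) \<Rightarrow> ennreal" and x
  proof -
    have "(\<lambda>t. x(k := t)) \<in> lborel \<rightarrow>\<^sub>M lborel_Rn d"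
      unfolding lborel_Rn_def
      by (subst ins) (rule measurable_component_update[OF that(2)], simp)
    then show ?thesis using that(1) by measurable
  qed
  let ?H = "\<lambda>x. F (x(k := a * x k + c x))"
  have H: "?H \<in> borel_measurable (lborel_Rn d)" by measurable
  have "ennreal \<bar>a\<bar> * (\<integral>\<^sup>+x. ?H x \<partial>lborel_Rn d) =
      ennreal \<bar>a\<bar> * (\<integral>\<^sup>+x. (\<integral>\<^sup>+t. ?H (x(k := t)) \<partial>lborel) \<partial>Pi\<^sub>M ?J (\<lambda>_. lborel))"
    by (subst Fubini[OF H]) (rule refl)
  also have "\<dots> = (\<integral>\<^sup>+x. ennreal \<bar>a\<bar> * (\<integral>\<^sup>+t. ?H (x(k := t)) \<partial>lborel) \<partial>Pi\<^sub>M ?J (\<lambda>_. lborel))"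
  proof (rule nn_integral_cmult[symmetric])
    have H': "?H \<in> borel_measurable (Pi\<^sub>M (insert k ?J) (\<lambda>_. lborel))"
      using H unfolding lborel_Rn_def ins[symmetric] .
    have "(\<lambda>(x, t). ?H (x(k := t))) \<in> borel_measurable (Pi\<^sub>M ?J (\<lambda>_. lborel) \<Otimes>\<^sub>M lborel)"
      using measurable_comp[OF measurable_add_dim H'] by (simp add: comp_def split_beta')
    then show "(\<lambda>x. \<integral>\<^sup>+t. ?H (x(k := t)) \<partial>lborel) \<in> borel_measurable (Pi\<^sub>M ?J (\<lambda>_. lborel))"
      by (rule lborel.borel_measurable_nn_integral)
  qed
  also have "\<dots> = (\<integral>\<^sup>+x. (\<integral>\<^sup>+t. F (x(k := t)) \<partial>lborel) \<partial>Pi\<^sub>M ?J (\<lambda>_. lborel))"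
  proof (rule nn_integral_cong)
    fix x assume x: "x \<in> space (Pi\<^sub>M ?J (\<lambda>_. lborel :: real measure))"
    show "ennreal \<bar>a\<bar> * (\<integral>\<^sup>+t. ?H (x(k := t)) \<partial>lborel) = (\<integral>\<^sup>+t. F (x(k := t)) \<partial>lborel)"
      using nn_integral_real_affine[of "\<lambda>t. F (x(k := t))" a "c x"] upd[OF F x] a
      by (simp add: ck add.commute)
  qed
  also have "\<dots> = (\<integral>\<^sup>+x. F x \<partial>lborel_Rn d)"
    by (rule Fubini[OF F, symmetric])
  finally show "ennreal \<bar>a\<bar> * (\<integral>\<^sup>+x. ?H x \<partial>lborel_Rn d) = (\<integral>\<^sup>+x. F x \<partial>lborel_Rn d)" .
qed

text \<open>Shear one coordinate at a time. Each step is an update of slope 1, and since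
  \<open>k\<close> is not in \<open>J\<close> the driving value \<open>x k\<close> stays fixed
  throughout.\<close>

lemma scales_volume_shears:
  assumes k: "k < d" and "finite J" "J \<subseteq> {..<d} - {k}"
  shows "scales_volume d (\<lambda>x. \<lambda>i\<in>{..<d}. if i \<in> J then x i + w i * x k else x i) 1"
  using assms(2,3)
proof (induction J rule: finite_induct)
  case empty
  have "scales_volume d (\<lambda>x. x) 1" by (auto simp: scales_volume_def)
  then show ?case
    by (rule scales_volume_cong[THEN iffD1, rotated]) (auto simp: space_lborel_Rn)
next
  case (insert j J)
  let ?W = "\<lambda>J x. \<lambda>i\<in>{..<d}. if i \<in> J then x i + w i * x k else x i"
  let ?U = "\<lambda>x. x(j := 1 * x j + w j * x k)"
  have j: "j < d" "j \<noteq> k" and J: "J \<subseteq> {..<d} - {k}" using insert.prems by auto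
  have U: "scales_volume d ?U \<bar>1\<bar>"
    using j k by (intro scales_volume_update) (auto intro!: borel_measurable_times)
  have "scales_volume d (?U \<circ> ?W J) (\<bar>1\<bar> * 1)"
    by (rule scales_volume_comp[OF U insert.IH[OF J]]) simp_all
  moreover have "?U \<circ> ?W J = ?W (insert j J)"
    using j k J insert.hyps by (auto simp: fun_eq_iff)
  ultimately show ?case by (simp only: abs_one mult_1)
qed

text \<open>With \<open>v k \<noteq> 0\<close>, replace the \<open>k\<close>-th coordinate by \<open>s = v \<bullet> x\<close>.  In the new coordinates the reflection
  sends \<open>s\<close> to \<open>-s\<close> and shears every other coordinate by \<open>-2 v i s\<close>, so it is a product of updates of
  single coordinates, each accessible to Fubini.\<close>

lemma scales_volume_householder:
  assumes v: "(\<Sum>i<d. (v i)\<^sup>2) = 1"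
  shows "scales_volume d (householder d v) 1"
proof -
  obtain k where k: "k < d" and vk: "v k \<noteq> 0"
  proof (rule ccontr)
    assume "\<not> thesis"
    with that have "\<forall>k<d. v k = 0" by blast
    then have "(\<Sum>i<d. (v i)\<^sup>2) = 0" by simp
    with v show False by simp
  qed
  let ?J = "{..<d} - {k}"
  define T where "T x = x(k := v k * x k + (\<Sum>j\<in>?J. v j * x j))" for x :: "nat \<Rightarrow> real"
  define W where "W x = (\<lambda>i\<in>{..<d}. if i \<in> ?J then x i + (- 2 * v i) * x k else x i)" for x :: "nat \<Rightarrow> real"
  \<comment> \<open>\<open>R\<close> returns to the original coordinates. Its input has s in place
    \<open>k\<close> and the reflected entries elsewhere; as the reflected point has inner product
    -s with \<open>v\<close>, the missing entry is found by solving for it, with the sign change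
    built in.\<close>
  define R where "R x = x(k := (- 1 / v k) * x k + (\<Sum>j\<in>?J. - (v j / v k) * x j))" for x :: "nat \<Rightarrow> real"
  have T: "scales_volume d T \<bar>v k\<bar>"
    unfolding T_def using k vk
    by (intro scales_volume_update) (auto intro!: borel_measurable_sum borel_measurable_times sum.cong)
  have W: "scales_volume d W 1"
    unfolding W_def using k by (intro scales_volume_shears) auto
  have R: "scales_volume d R \<bar>- 1 / v k\<bar>"
    unfolding R_def using k vk
    by (intro scales_volume_update) (auto intro!: borel_measurable_sum borel_measurable_times sum.cong)
  have "scales_volume d (R \<circ> (W \<circ> T)) (\<bar>- 1 / v k\<bar> * (1 * \<bar>v k\<bar>))"
    by (intro scales_volume_comp T W R) auto
  then have "scales_volume d (R \<circ> (W \<circ> T)) 1" using vk by simp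
  moreover have "(R \<circ> (W \<circ> T)) x = householder d v x" if x: "x \<in> space (lborel_Rn d)" for x
  proof
    fix i
    let ?s = "\<Sum>j<d. v j * x j"
    have s: "?s = v k * x k + (\<Sum>j\<in>?J. v j * x j)" and one: "1 = (v k)\<^sup>2 + (\<Sum>j\<in>?J. (v j)\<^sup>2)"
      using k v by (auto simp: sum.remove[of "{..<d}" k])
    have Tk: "T x k = ?s" by (simp add: T_def s)
    have WT: "W (T x) j = x j - 2 * v j * ?s" if "j \<in> ?J" for j
      using that by (simp add: W_def Tk) (simp add: T_def)
    have WTk: "W (T x) k = ?s" using k by (simp add: W_def Tk)
    consider "i = k" | "i \<in> ?J" | "\<not> i < d" by auto
    then show "(R \<circ> (W \<circ> T)) x i = householder d v x i"
    proof cases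
      case 1
      have "v k * R (W (T x)) k = - ?s - (\<Sum>j\<in>?J. v j * W (T x) j)"
        using vk by (simp add: R_def WTk field_simps sum_divide_distrib[symmetric] sum_negf)
      also have "(\<Sum>j\<in>?J. v j * W (T x) j) = (\<Sum>j\<in>?J. v j * x j - 2 * ?s * (v j)\<^sup>2)"
        by (intro sum.cong) (auto simp: WT algebra_simps power2_eq_square)
      also have "\<dots> = (\<Sum>j\<in>?J. v j * x j) - 2 * ?s * (\<Sum>j\<in>?J. (v j)\<^sup>2)"
        by (simp add: sum_subtractf sum_distrib_left)
      also have "(\<Sum>j\<in>?J. v j * x j) = ?s - v k * x k" using s by simp
      \<comment> \<open>Unit length turns the sum of the other squares into 1 - v_k^2; the terms in
        s without v_k^2 cancel and a factor v_k comes out.\<close>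
      also have "(\<Sum>j\<in>?J. (v j)\<^sup>2) = 1 - (v k)\<^sup>2" using one by simp
      finally have "v k * R (W (T x)) k = v k * (x k - 2 * v k * ?s)"
        by (simp add: algebra_simps power2_eq_square)
      then show ?thesis using 1 k vk by (simp add: householder_def)
    next
      case 2
      then show ?thesis by (auto simp: R_def WT householder_def)
    next
      case 3
      then show ?thesis using k by (auto simp: R_def W_def householder_def)
    qed
  qed
  ultimately show ?thesis using scales_volume_cong by blast
qed

section \<open>Algebra of reflections and of their compositions\<close>

lemma sum_householder:
  assumes "(\<Sum>i<d. (v i)\<^sup>2) = 1"
  shows "(\<Sum>i<d. v i * householder d v z i) = - (\<Sum>i<d. v i * z i)"
proof -
  let ?s = "\<Sum>i<d. v i * z i"
  have "(\<Sum>i<d. v i * householder d v z i) = (\<Sum>i<d. v i * z i - 2 * ?s * (v i)\<^sup>2)"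
    by (intro sum.cong) (auto simp: householder_def algebra_simps power2_eq_square)
  also have "\<dots> = ?s - 2 * ?s * (\<Sum>i<d. (v i)\<^sup>2)"
    by (simp only: sum_subtractf sum_distrib_left)
  finally show ?thesis using assms by simp
qed

lemma householder_involution:
  assumes "(\<Sum>i<d. (v i)\<^sup>2) = 1" and "z \<in> space (lborel_Rn d)"
  shows "householder d v (householder d v z) = z"
proof
  fix i
  show "householder d v (householder d v z) i = z i"
  proof (cases "i < d")
    case True
    have "householder d v (householder d v z) i =
        householder d v z i - 2 * v i * (\<Sum>j<d. v j * householder d v z j)"
      using True by (simp add: householder_def[of d v "householder d v z"])
    also have "\<dots> = householder d v z i + 2 * v i * (\<Sum>j<d. v j * z j)"
      by (simp add: sum_householder[OF assms(1)])
    also have "\<dots> = z i"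
      using True by (simp add: householder_def)
    finally show ?thesis .
  next
    case False
    \<comment> \<open>Outside \<open>{..<d}\<close> the restriction in \<open>householder\<close>
      gives \<open>undefined\<close>, which agrees with \<open>z\<close> only because
      \<open>z\<close> is extensional.\<close>
    then have "z i = undefined" using assms(2) by (auto simp: space_lborel_Rn)
    then show ?thesis using False by (simp add: householder_def[of d v "householder d v z"])
  qed
qed

text \<open>With s = v . z, the cross terms contribute -4 s^2 and the squares 4 s^2 |v|^2, which
  cancel for a unit vector.\<close>

lemma sq_norm_householder:
  assumes "(\<Sum>i<d. (v i)\<^sup>2) = 1"
  shows "sq_norm d (householder d v z) = sq_norm d z"
proof -
  let ?s = "\<Sum>i<d. v i * z i"
  have "sq_norm d (householder d v z) = (\<Sum>i<d. (z i)\<^sup>2 - 4 * ?s * (v i * z i) + 4 * ?s\<^sup>2 * (v i)\<^sup>2)"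
    unfolding sq_norm_def
    by (intro sum.cong) (auto simp: householder_def algebra_simps power2_eq_square)
  also have "\<dots> = (\<Sum>i<d. (z i)\<^sup>2) - 4 * ?s * ?s + 4 * ?s\<^sup>2 * (\<Sum>i<d. (v i)\<^sup>2)"
    by (simp only: sum.distrib sum_subtractf sum_distrib_left)
  finally show ?thesis using assms by (simp add: sq_norm_def power2_eq_square)
qed

text \<open>The two invariances behind the lower bound: the first transports densities and
  \<open>L1_norm\<close> distances, the second fixes the standard Gaussian density.\<close>

definition volume_isometry :: "nat \<Rightarrow> ((nat \<Rightarrow> real) \<Rightarrow> (nat \<Rightarrow> real)) \<Rightarrow> bool" where
  "volume_isometry d f \<longleftrightarrow> scales_volume d f 1 \<and>
     (\<forall>x\<in>space (lborel_Rn d). sq_norm d (f x) = sq_norm d x)"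

lemma volume_isometry_measurable: "volume_isometry d f \<Longrightarrow> f \<in> lborel_Rn d \<rightarrow>\<^sub>M lborel_Rn d"
  by (simp add: volume_isometry_def scales_volume_def)

lemma volume_isometry_distr:
  "volume_isometry d f \<Longrightarrow> distr (lborel_Rn d) (lborel_Rn d) f = lborel_Rn d"
  by (simp add: volume_isometry_def scales_volume_one_imp_distr)

lemma volume_isometry_comp:
  assumes "volume_isometry d f" "volume_isometry d g"
  shows "volume_isometry d (f \<circ> g)"
  using assms scales_volume_comp[of d f 1 g 1] measurable_space[OF volume_isometry_measurable[OF assms(2)]]
  by (auto simp: volume_isometry_def)

lemma volume_isometry_id: "volume_isometry d id"
  by (simp add: volume_isometry_def scales_volume_def)

text \<open>The left inverse is carried along because the pushed density is \<open>q\<close>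
  composed with it. Each reflection is its own inverse, so a new outermost flow \<open>h\<close>
  changes \<open>g\<close> into \<open>g \<circ> h\<close>.\<close>

lemma householder_flows_composition:
  assumes "set fs \<subseteq> householder_flows d"
  shows "volume_isometry d (foldr (\<circ>) fs id) \<and>
    (\<exists>g. volume_isometry d g \<and> (\<forall>x\<in>space (lborel_Rn d). g (foldr (\<circ>) fs id x) = x))"
  using assms
proof (induction fs)
  case Nil
  show ?case using volume_isometry_id[of d] by (auto simp: id_def intro!: exI[of _ "\<lambda>x. x"])
next
  case (Cons h fs)
  define f where "f = foldr (\<circ>) fs id"
  obtain g where f: "volume_isometry d f" and g: "volume_isometry d g"
    "\<And>x. x \<in> space (lborel_Rn d) \<Longrightarrow> g (f x) = x"
  proof -
    have "set fs \<subseteq> householder_flows d" using Cons.prems by simp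
    from Cons.IH[OF this] show thesis using that unfolding f_def by blast
  qed
  obtain v where h: "h = householder d v" and v: "(\<Sum>i<d. (v i)\<^sup>2) = 1"
    using Cons.prems by (auto simp: householder_flows_def)
  have vh: "volume_isometry d h"
    by (simp add: h volume_isometry_def scales_volume_householder[OF v] sq_norm_householder[OF v])
  have "(g \<circ> h) (h (f x)) = x" if "x \<in> space (lborel_Rn d)" for x
    using that g(2) householder_involution[OF v] measurable_space[OF volume_isometry_measurable[OF f]]
    by (simp add: h)
  moreover have "foldr (\<circ>) (h # fs) id = h \<circ> f" by (simp add: f_def)
  ultimately show ?case
    using volume_isometry_comp[OF vh f] volume_isometry_comp[OF g(1) vh] by (metis comp_apply)
qed

section \<open>Transport of densities\<close>

text \<open>As \<open>f\<close> preserves Lebesgue measure, the measure with density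
  \<open>q \<circ> g\<close> is the image under \<open>f\<close> of the one with density
  \<open>q \<circ> g \<circ> f\<close>, which is \<open>q\<close>. Uniqueness of Radon-Nikodym
  derivatives gives equality almost everywhere.\<close>

lemma push_density_volume_isometry:
  assumes f: "volume_isometry d f" and g: "volume_isometry d g"
    and gf: "\<And>x. x \<in> space (lborel_Rn d) \<Longrightarrow> g (f x) = x"
    and q: "prob_density d q"
  shows "AE x in lborel_Rn d. push_density d f q x = q (g x)"
proof -
  note [measurable] = volume_isometry_measurable[OF f] volume_isometry_measurable[OF g]
  have q_meas[measurable]: "q \<in> borel_measurable (lborel_Rn d)"
    and q_nonneg: "AE x in lborel_Rn d. 0 \<le> q x"
    using q by (auto simp: prob_density_def)
  let ?L = "lborel_Rn d" and ?h = "\<lambda>x. ennreal (q (g x))"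
  have "density ?L ?h = density (distr ?L ?L f) ?h"
    by (simp add: volume_isometry_distr[OF f])
  also have "\<dots> = distr (density ?L (\<lambda>x. ?h (f x))) ?L f"
    by (rule density_distr) auto
  also have "density ?L (\<lambda>x. ?h (f x)) = density ?L (\<lambda>x. ennreal (q x))"
    by (rule density_cong) (auto simp: gf)
  finally have "AE x in ?L. ?h x = RN_deriv ?L (distr (density ?L (\<lambda>x. ennreal (q x))) ?L f) x"
    by (intro sigma_finite_measure.RN_deriv_unique[OF sigma_finite_lborel_Rn]) auto
  \<comment> \<open>\<open>enn2real\<close> recovers \<open>q (g x)\<close> only where it is
    nonnegative. This holds almost everywhere, since \<open>g\<close> preserves the measure.\<close>
  moreover have "AE x in distr ?L ?L g. 0 \<le> q x"
    using q_nonneg unfolding volume_isometry_distr[OF g] .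
  from AE_distrD[OF volume_isometry_measurable[OF g] this] have "AE x in ?L. 0 \<le> q (g x)" .
  ultimately show ?thesis
    unfolding push_density_def by eventually_elim (metis enn2real_ennreal)
qed

lemma push_density_measurable [measurable]:
  "push_density d f q \<in> borel_measurable (lborel_Rn d)"
  unfolding push_density_def by measurable

lemma prob_density_integrable: "prob_density d q \<Longrightarrow> integrable (lborel_Rn d) q"
  unfolding prob_density_def by (intro integrableI_nonneg) auto

lemma L1_norm_triangle:
  assumes "integrable (lborel_Rn d) f" "integrable (lborel_Rn d) g" "integrable (lborel_Rn d) h"
  shows "L1_norm d (\<lambda>x. f x - h x) \<le> L1_norm d (\<lambda>x. f x - g x) + L1_norm d (\<lambda>x. g x - h x)"
proof -
  have "L1_norm d (\<lambda>x. f x - h x) \<le> (\<integral>x. \<bar>f x - g x\<bar> + \<bar>g x - h x\<bar> \<partial>lborel_Rn d)"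
    unfolding L1_norm_def using assms by (intro integral_mono) auto
  also have "\<dots> = L1_norm d (\<lambda>x. f x - g x) + L1_norm d (\<lambda>x. g x - h x)"
    unfolding L1_norm_def using assms by (intro Bochner_Integration.integral_add) auto
  finally show ?thesis .
qed

lemma L1_norm_commute: "L1_norm d (\<lambda>x. f x - g x) = L1_norm d (\<lambda>x. g x - f x)"
  by (simp add: L1_norm_def abs_minus_commute)

text \<open>Replace the pushed density by \<open>q \<circ> g\<close> and \<open>r\<close> by
  \<open>r \<circ> g\<close>; then \<open>g\<close> drops out by invariance of the measure. The
  intended \<open>r\<close> is the standard Gaussian density.\<close>

lemma push_density_L1:
  assumes f: "volume_isometry d f" and g: "volume_isometry d g"
    and gf: "\<And>x. x \<in> space (lborel_Rn d) \<Longrightarrow> g (f x) = x"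
    and q: "prob_density d q"
    and r[measurable]: "r \<in> borel_measurable (lborel_Rn d)"
    and rg: "\<And>x. x \<in> space (lborel_Rn d) \<Longrightarrow> r (g x) = r x"
  shows "integrable (lborel_Rn d) (push_density d f q)"
    and "L1_norm d (\<lambda>x. push_density d f q x - r x) = L1_norm d (\<lambda>x. q x - r x)"
proof -
  note [measurable] = volume_isometry_measurable[OF g]
  have q_meas[measurable]: "q \<in> borel_measurable (lborel_Rn d)"
    using q by (auto simp: prob_density_def)
  note ae = push_density_volume_isometry[OF f g gf q]
  have "integrable (lborel_Rn d) (\<lambda>x. q (g x))"
    using prob_density_integrable[OF q]
    by (intro integrable_distr[OF volume_isometry_measurable[OF g]]) (simp add: volume_isometry_distr[OF g])
  then show "integrable (lborel_Rn d) (push_density d f q)"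
    by (subst integrable_cong_AE[OF _ _ ae]) auto
  have "(\<integral>x. \<bar>push_density d f q x - r x\<bar> \<partial>lborel_Rn d) = (\<integral>x. \<bar>q (g x) - r (g x)\<bar> \<partial>lborel_Rn d)"
    using ae by (intro integral_cong_AE) (auto simp: rg elim!: eventually_mono)
  also have "\<dots> = (\<integral>x. \<bar>q x - r x\<bar> \<partial>distr (lborel_Rn d) (lborel_Rn d) g)"
    by (subst integral_distr) auto
  finally show "L1_norm d (\<lambda>x. push_density d f q x - r x) = L1_norm d (\<lambda>x. q x - r x)"
    by (simp add: L1_norm_def volume_isometry_distr[OF g])
qed

section \<open>Gaussians close to the standard one\<close>

text \<open>Only a = 1 gives a probability density. The normalisation is kept fixed in
  \<open>a\<close>, so that these functions are pointwise monotone in \<open>a\<close>; the total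
  mass is a^(-d/2).\<close>

definition iso_gauss :: "nat \<Rightarrow> real \<Rightarrow> (nat \<Rightarrow> real) \<Rightarrow> real" where
  "iso_gauss d a x = exp (- (a * sq_norm d x) / 2) / sqrt ((2 * pi) ^ d)"

lemma sq_norm_measurable [measurable]: "sq_norm d \<in> borel_measurable (lborel_Rn d)"
  unfolding sq_norm_def by measurable

lemma iso_gauss_measurable [measurable]: "iso_gauss d a \<in> borel_measurable (lborel_Rn d)"
  unfolding iso_gauss_def by measurable

lemma sq_norm_nonneg: "0 \<le> sq_norm d x"
  by (simp add: sq_norm_def sum_nonneg)

lemma iso_gauss_antimono: "a \<le> b \<Longrightarrow> iso_gauss d b x \<le> iso_gauss d a x"
  unfolding iso_gauss_def
  by (intro divide_right_mono) (auto intro!: mult_right_mono sq_norm_nonneg)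

lemma iso_gauss_integral:
  assumes "0 < a"
  shows "integrable (lborel_Rn d) (iso_gauss d a)"
    and "(\<integral>x. iso_gauss d a x \<partial>lborel_Rn d) = 1 / sqrt (a ^ d)"
proof -
  \<comment> \<open>The one-dimensional factor: a normal density of variance 1/a, rescaled to the
    normalisation of a = 1.\<close>
  let ?\<phi> = "\<lambda>t. normal_density 0 (1 / sqrt a) t / sqrt a"
  have \<phi>: "?\<phi> t = exp (- (a * t\<^sup>2) / 2) / sqrt (2 * pi)" for t
    using assms by (simp add: normal_density_def power_divide real_sqrt_divide mult.commute)
  have prod: "iso_gauss d a = (\<lambda>x. \<Prod>i<d. ?\<phi> (x i))"
    unfolding \<phi>
    by (simp add: fun_eq_iff iso_gauss_def sq_norm_def prod_dividef exp_sum[symmetric] real_sqrt_power real_sqrt_mult power_mult_distrib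
        sum_negf sum_distrib_left sum_divide_distrib)
  have int: "integrable lborel ?\<phi>" using assms by simp
  show "integrable (lborel_Rn d) (iso_gauss d a)"
    unfolding prod lborel_Rn_def by (intro lborel_prod.product_integrable_prod int) simp
  have "(\<integral>x. iso_gauss d a x \<partial>lborel_Rn d) = (\<Prod>i<d. \<integral>t. ?\<phi> t \<partial>lborel)"
    unfolding prod lborel_Rn_def by (intro lborel_prod.product_integral_prod int) simp
  also have "\<dots> = 1 / sqrt (a ^ d)"
    using assms by (simp add: power_divide real_sqrt_power)
  finally show "(\<integral>x. iso_gauss d a x \<partial>lborel_Rn d) = 1 / sqrt (a ^ d)" .
qed

lemma gaussian_density_measurable:
  assumes "the (mat_inverse \<Sigma>) \<in> carrier_mat d d"
  shows "gaussian_density d \<Sigma> \<in> borel_measurable (lborel_Rn d)"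
proof -
  let ?B = "the (mat_inverse \<Sigma>)"
  have "scalar_prod (Matrix.vec d x) (?B *\<^sub>v Matrix.vec d x) = (\<Sum>i<d. x i * (\<Sum>j<d. ?B $$ (i, j) * x j))"
    for x using assms by (simp add: scalar_prod_def atLeast0LessThan)
  then have "gaussian_density d \<Sigma> = (\<lambda>x. exp (- (\<Sum>i<d. x i * (\<Sum>j<d. ?B $$ (i, j) * x j)) / 2)
      / sqrt ((2 * pi) ^ d * Determinant.det \<Sigma>))"
    by (simp add: gaussian_density_def fun_eq_iff)
  then show ?thesis by simp
qed

text \<open>Both densities lie between \<open>lo\<close> and \<open>up\<close>, multiples of isotropic Gaussians, so their \<open>L\<^sup>1\<close>
  distance is at most the difference of two explicit integrals.\<close>

lemma gaussian_density_near_standard: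
  fixes S :: "real mat" and d :: nat
  defines "p \<equiv> gaussian_density d (1\<^sub>m d + S)"
  assumes S: "S \<in> carrier_mat d d"
    and s: "\<And>i j. i < d \<Longrightarrow> j < d \<Longrightarrow> \<bar>S $$ (i, j)\<bar> \<le> s"
    and t: "t = (real d)\<^sup>2 * s" "t \<le> 1 / 4" and d: "0 < d" and s0: "0 \<le> s"
  shows "integrable (lborel_Rn d) p"
    and "L1_norm d (\<lambda>x. p x - iso_gauss d 1 x) \<le> 1 / sqrt ((1 - 2 * t) * (2 - exp t)) - 1 / sqrt (exp (3 * t))"
proof -
  \<comment> \<open>Two scales: \<open>d * s\<close> governs the quadratic form, while t = d^2 s
    governs the determinant and the masses, where d-th powers occur.\<close>
  let ?\<eta> = "real d * s" and ?D = "Determinant.det (1\<^sub>m d + S)"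
  have \<eta>: "0 \<le> ?\<eta>" and d\<eta>: "real d * ?\<eta> = t" and \<eta>t: "?\<eta> \<le> t"
    using s0 t d mult_right_mono[of 1 "real d" "?\<eta>"] by (auto simp: power2_eq_square)
  have pow: "(1 + c * ?\<eta>) ^ d \<le> exp (c * t)" if "0 \<le> c" for c
  proof -
    have "(1 + c * ?\<eta>) ^ d \<le> exp (c * ?\<eta>) ^ d"
      using that \<eta> by (intro power_mono) auto
    also have "\<dots> = exp (real d * (c * ?\<eta>))" by (rule exp_of_nat_mult[symmetric])
    also have "real d * (c * ?\<eta>) = c * t" using d\<eta> by (simp add: algebra_simps)
    finally show ?thesis .
  qed
  have t0: "0 \<le> t" using \<eta> \<eta>t by simp
  have E1: "1 \<le> exp t" using t0 by simp
  \<comment> \<open>Keeps the lower bound 2 - exp t for the determinant positive.\<close>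
  have E2: "exp t < 2"
  proof -
    have "exp t \<le> 1 + t + t\<^sup>2" using t0 t by (intro exp_bound) auto
    also have "t\<^sup>2 \<le> 1 * t" unfolding power2_eq_square using t0 t by (intro mult_right_mono) auto
    finally show ?thesis using t(2) by linarith
  qed
  have "\<bar>?D - 1\<bar> \<le> exp t - 1"
    using det_one_plus_bound[OF S s] pow[of 1] by simp
  then have D: "2 - exp t \<le> ?D" "?D \<le> exp t" by auto
  then have D0: "0 < ?D" using E2 by simp
  have B: "the (mat_inverse (1\<^sub>m d + S)) \<in> carrier_mat d d"
    using S D0 by (intro the_mat_inverse) auto
  \<comment> \<open>Each envelope pairs an extreme of the quadratic form with an extreme of the
    determinant. The exponent 1 and determinant 1 of the standard Gaussian lie within the same
    ranges.\<close>
  define lo where "lo x = iso_gauss d (1 + 2 * ?\<eta>) x / sqrt (exp t)" for x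
  define up where "up x = iso_gauss d (1 - 2 * ?\<eta>) x / sqrt (2 - exp t)" for x
  have g0: "0 \<le> iso_gauss d a x" for a x by (simp add: iso_gauss_def)
  have pw: "lo x \<le> p x \<and> p x \<le> up x \<and> lo x \<le> iso_gauss d 1 x \<and> iso_gauss d 1 x \<le> up x" for x
  proof -
    define Q where "Q = scalar_prod (Matrix.vec d x) (the (mat_inverse (1\<^sub>m d + S)) *\<^sub>v Matrix.vec d x)"
    have "\<bar>Q - sq_norm d x\<bar> \<le> 2 * ?\<eta> * sq_norm d x"
      unfolding Q_def using S s s0 t \<eta>t D0 by (intro inverse_quadratic_form_bound) auto
    then have Q: "(1 - 2 * ?\<eta>) * sq_norm d x \<le> Q" "Q \<le> (1 + 2 * ?\<eta>) * sq_norm d x"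
      by (auto simp: algebra_simps abs_le_iff)
    define G where "G = exp (- Q / 2) / sqrt ((2 * pi) ^ d)"
    have p: "p x = G / sqrt ?D"
      by (simp add: p_def gaussian_density_def Q_def G_def real_sqrt_mult)
    have G: "iso_gauss d (1 + 2 * ?\<eta>) x \<le> G" "G \<le> iso_gauss d (1 - 2 * ?\<eta>) x"
      using Q unfolding G_def iso_gauss_def by (auto intro!: divide_right_mono)
    have 1: "iso_gauss d (1 + 2 * ?\<eta>) x \<le> iso_gauss d 1 x" "iso_gauss d 1 x \<le> iso_gauss d (1 - 2 * ?\<eta>) x"
      using \<eta> by (auto intro!: iso_gauss_antimono)
    have "lo x \<le> p x" "p x \<le> up x" unfolding lo_def up_def p
      using G D D0 E2 g0 by (auto intro!: frac_le order_trans[OF g0 G(1)] order_trans[OF g0 iso_gauss_antimono])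
    moreover have "lo x \<le> iso_gauss d 1 x / 1" "iso_gauss d 1 x / 1 \<le> up x" unfolding lo_def up_def
      using 1 E1 E2 g0 by (intro frac_le; simp)+
    ultimately show ?thesis by simp
  qed
  have a: "0 < 1 - 2 * ?\<eta>" "0 < 1 + 2 * ?\<eta>" using \<eta> \<eta>t t by auto
  have int: "integrable (lborel_Rn d) lo" "integrable (lborel_Rn d) up" "integrable (lborel_Rn d) (iso_gauss d 1)"
    unfolding lo_def up_def using a by (auto intro!: iso_gauss_integral)
  have p_meas[measurable]: "p \<in> borel_measurable (lborel_Rn d)"
    unfolding p_def by (rule gaussian_density_measurable[OF B])
  have lo0: "0 \<le> lo x" for x by (simp add: lo_def g0)
  have "\<bar>p x\<bar> \<le> \<bar>up x\<bar>" for x using pw[of x] lo0[of x] by linarith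
  then show p_int: "integrable (lborel_Rn d) p"
    by (intro Bochner_Integration.integrable_bound[OF int(2)]) auto
  have "L1_norm d (\<lambda>x. p x - iso_gauss d 1 x) \<le> (\<integral>x. up x - lo x \<partial>lborel_Rn d)"
    unfolding L1_norm_def
  proof (rule integral_mono)
    fix x show "\<bar>p x - iso_gauss d 1 x\<bar> \<le> up x - lo x" using pw[of x] by linarith
  qed (use int p_int in auto)
  also have "\<dots> = 1 / sqrt ((1 - 2 * ?\<eta>) ^ d * (2 - exp t)) - 1 / sqrt ((1 + 2 * ?\<eta>) ^ d * exp t)"
    unfolding Bochner_Integration.integral_diff[OF int(2,1)]
    using iso_gauss_integral(2)[OF a(1), of d] iso_gauss_integral(2)[OF a(2), of d]
    by (simp add: lo_def[abs_def] up_def[abs_def] real_sqrt_mult)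
  also have "\<dots> \<le> 1 / sqrt ((1 - 2 * t) * (2 - exp t)) - 1 / sqrt (exp (2 * t) * exp t)"
  proof (rule diff_mono)
    \<comment> \<open>Bernoulli bounds the power in \<open>up\<close> from below and the exponential
      bounds the one in \<open>lo\<close> from above, so the final estimate depends on
      \<open>t\<close> alone.\<close>
    have "1 + real d * (- 2 * ?\<eta>) \<le> (1 + (- 2 * ?\<eta>)) ^ d"
      using a by (intro Bernoulli_inequality) auto
    then have "1 - 2 * t \<le> (1 - 2 * ?\<eta>) ^ d" using d\<eta> by (simp add: algebra_simps)
    then show "1 / sqrt ((1 - 2 * ?\<eta>) ^ d * (2 - exp t)) \<le> 1 / sqrt ((1 - 2 * t) * (2 - exp t))"
      using E2 t by (intro divide_left_mono real_sqrt_le_mono mult_right_mono) (auto intro!: mult_pos_pos zero_less_power a)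
    show "1 / sqrt (exp (2 * t) * exp t) \<le> 1 / sqrt ((1 + 2 * ?\<eta>) ^ d * exp t)"
      using pow[of 2] a by (intro divide_left_mono real_sqrt_le_mono mult_right_mono) (auto intro!: mult_pos_pos zero_less_power)
  qed
  finally show "L1_norm d (\<lambda>x. p x - iso_gauss d 1 x) \<le> 1 / sqrt ((1 - 2 * t) * (2 - exp t)) - 1 / sqrt (exp (3 * t))"
    by (simp add: exp_add[symmetric])
qed

section \<open>The lower bound\<close>

text \<open>The triangle inequality is used twice through the standard Gaussian, whose distance to
  \<open>q\<close> equals its distance to the pushed density. The length of \<open>fs\<close> does
  not enter.\<close>

lemma householder_flows_cannot_approximate:
  assumes q: "prob_density d q" and p: "integrable (lborel_Rn d) p"
    and fs: "set fs \<subseteq> householder_flows d"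
  shows "L1_norm d (\<lambda>x. p x - q x) \<le> L1_norm d (\<lambda>x. push_density d (foldr (\<circ>) fs id) q x - p x)
           + 2 * L1_norm d (\<lambda>x. p x - iso_gauss d 1 x)"
proof -
  let ?f = "foldr (\<circ>) fs id" and ?\<phi> = "iso_gauss d 1"
  obtain g where f: "volume_isometry d ?f" and g: "volume_isometry d g"
    and gf: "\<And>x. x \<in> space (lborel_Rn d) \<Longrightarrow> g (?f x) = x"
    using householder_flows_composition[OF fs] by blast
  have \<phi>g: "?\<phi> (g x) = ?\<phi> x" if "x \<in> space (lborel_Rn d)" for x
    using g that by (simp add: iso_gauss_def volume_isometry_def)
  note push = push_density_L1[OF f g gf q iso_gauss_measurable \<phi>g]
  have \<phi>: "integrable (lborel_Rn d) ?\<phi>" by (rule iso_gauss_integral) simp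
  have "L1_norm d (\<lambda>x. p x - q x) \<le> L1_norm d (\<lambda>x. p x - ?\<phi> x) + L1_norm d (\<lambda>x. ?\<phi> x - q x)"
    by (intro L1_norm_triangle p \<phi> prob_density_integrable q)
  also have "L1_norm d (\<lambda>x. ?\<phi> x - q x) = L1_norm d (\<lambda>x. push_density d ?f q x - ?\<phi> x)"
    by (subst push(2)) (auto intro: L1_norm_commute)
  also have "\<dots> \<le> L1_norm d (\<lambda>x. push_density d ?f q x - p x) + L1_norm d (\<lambda>x. p x - ?\<phi> x)"
    by (intro L1_norm_triangle p \<phi> push(1)) auto
  finally show ?thesis by simp
qed

theorem theorem5p3:
  fixes \<kappa> :: real
    and S :: "nat \<Rightarrow> real mat"
    and p q :: "nat \<Rightarrow> (nat \<Rightarrow> real) \<Rightarrow> real"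
  assumes "\<kappa> > 0"
    and "\<And>d. d > 2 \<Longrightarrow> S d \<in> carrier_mat d d"
    and "\<And>d. d > 2 \<Longrightarrow> transpose_mat (S d) = S d"
    and "\<And>d i j. d > 2 \<Longrightarrow> i < d \<Longrightarrow> j < d \<Longrightarrow> \<bar>S d $$ (i, j)\<bar> \<le> real d powr (- (2 + \<kappa>))"
    and "\<And>d. d > 2 \<Longrightarrow> p d = gaussian_density d (1\<^sub>m d + S d)"
    and "\<And>d. d > 2 \<Longrightarrow> prob_density d (q d)"
    and "(\<lambda>d. L1_norm d (\<lambda>x. p d x - q d x)) \<in> \<Theta>(\<lambda>_. 1)"
  shows "\<exists>\<epsilon> :: nat \<Rightarrow> real. (\<forall>d>2. \<epsilon> d > 0) \<and> \<epsilon> \<in> \<Theta>(\<lambda>_. 1) \<and>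
           enat_bigomega (\<lambda>d. T_flows d (\<epsilon> d) (p d) (q d) (householder_flows d)) (\<lambda>d. real d powr \<kappa>)"
proof -
  obtain c where c: "0 < c" "eventually (\<lambda>d. c \<le> L1_norm d (\<lambda>x. p d x - q d x)) at_top"
  proof -
    have "(\<lambda>d. L1_norm d (\<lambda>x. p d x - q d x)) \<in> \<Omega>(\<lambda>_. 1)"
      using assms(7) by (rule bigthetaD2)
    then obtain c where "0 < c" "eventually (\<lambda>d. c \<le> \<bar>L1_norm d (\<lambda>x. p d x - q d x)\<bar>) at_top"
      by (elim landau_omega.bigE) auto
    then show thesis by (intro that) (auto simp: L1_norm_def)
  qed
  \<comment> \<open>This is d^2 s for s = d^(-(2 + \<kappa>)), and \<open>b\<close> is the Gaussian
    estimate as a function of it, continuous at 0 with value 0.\<close>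
  define t where "t d = real d powr (- \<kappa>)" for d
  define b where "b u = 1 / sqrt ((1 - 2 * u) * (2 - exp u)) - 1 / sqrt (exp (3 * u))" for u :: real
  have t0: "t \<longlonglongrightarrow> 0"
    unfolding t_def using assms(1) by (intro tendsto_neg_powr filterlim_real_sequentially) auto
  have "(\<lambda>d. b (t d)) \<longlonglongrightarrow> 1 / sqrt ((1 - 2 * 0) * (2 - exp 0)) - 1 / sqrt (exp (3 * 0))"
    unfolding b_def by (intro tendsto_intros t0) auto
  then have b0: "(\<lambda>d. b (t d)) \<longlonglongrightarrow> 0" by simp
  \<comment> \<open>Once b < c/4, flows reaching c/2 would give c \<le> c/2 + 2 b < c. The condition
    t < 1/4 admits the Gaussian estimate.\<close>
  have "eventually (\<lambda>d. T_flows d (c / 2) (p d) (q d) (householder_flows d) = \<infinity>) at_top"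
    using c(2) eventually_gt_at_top[of 2]
      order_tendstoD(2)[OF t0, of "1 / 4", simplified] order_tendstoD(2)[OF b0, of "c / 4", simplified, OF c(1)]
  proof eventually_elim
    case (elim d)
    have d: "2 < d" by fact
    have "(real d)\<^sup>2 * real d powr (- (2 + \<kappa>)) = real d powr 2 * real d powr (- (2 + \<kappa>))"
      using d by simp
    also have "\<dots> = t d" unfolding t_def powr_add[symmetric] by simp
    finally have td: "t d = (real d)\<^sup>2 * real d powr (- (2 + \<kappa>))" by simp
    note near = gaussian_density_near_standard[OF assms(2,4)[OF d] td, unfolded assms(5)[OF d, symmetric]]
    have p: "integrable (lborel_Rn d) (p d)" using elim d by (intro near) auto
    have "L1_norm d (\<lambda>x. p d x - iso_gauss d 1 x) \<le> b (t d)"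
      unfolding b_def using elim d by (intro near) auto
    then have "\<not> L1_norm d (\<lambda>x. push_density d (foldr (\<circ>) fs id) (q d) x - p d x) \<le> c / 2"
      if "set fs \<subseteq> householder_flows d" for fs
      using householder_flows_cannot_approximate[OF assms(6)[OF d] p that] elim by linarith
    then have "{enat (length fs) | fs. set fs \<subseteq> householder_flows d \<and>
        L1_norm d (\<lambda>x. push_density d (foldr (\<circ>) fs id) (q d) x - p d x) \<le> c / 2} = {}"
      by blast
    then show ?case unfolding T_flows_def by (simp only:) (simp add: top_enat_def)
  qed
  \<comment> \<open>An infinite value exceeds every multiple of d^\<kappa>, so the constant 1
    serves.\<close>
  then have "enat_bigomega (\<lambda>d. T_flows d (c / 2) (p d) (q d) (householder_flows d)) (\<lambda>d. real d powr \<kappa>)"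
    unfolding enat_bigomega_def by (intro exI[of _ 1] conjI) (auto elim!: eventually_mono)
  moreover have "(\<lambda>_ :: nat. c / 2) \<in> \<Theta>(\<lambda>_. 1)" using c(1) by simp
  ultimately show ?thesis using c(1) by (intro exI[of _ "\<lambda>_. c / 2"]) auto
qed

end
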